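(* Let $N$ and $M$ be positive integers with $M\le N$, and let $\mathcal{M}_z=\{n^{(0)}_z,n^{(1)}_z,\dots,n^{(M-1)}_z\}$ be a set of integers (coset indices) with $0\le n^{(0)}_z<n^{(1)}_z<\dots<n^{(M-1)}_z\le N-1$. Let ${\bf R}_{c_z}$ be the $M(M-1)\times(N-1)$ matrix associated with $\mathcal{M}_z$ as defined in the context. Then ${\bf R}_{c_z}$ has full column rank (i.e., rank $N-1$) if and only if $\mathcal{M}_z$ is a circular sparse ruler of length $N-1$.
   Context: Throughout, $z$ is a fixed index (labelling a group of sensors), and $\delta[\cdot]$ is the Kronecker delta on the integers ($\delta[0]=1$ and $\delta[k]=0$ for $k\ne 0$). Selection filters. Let ${\bf C}_z$ be the $M\times N$ matrix whose rows are the rows of the $N\times N$ identity matrix with indices (counted from $0$) $n^{(0)}_z,\dots,n^{(M-1)}_z$. Write the row of ${\bf C}_z$ with index $m\in\{0,\dots,M-1\}$ as $[c^{(m)}_z[0],c^{(m)}_z[-1],\dots,c^{(m)}_z[1-N]]$. Thus $c^{(m)}_z[n]=\delta[n+n^{(m)}_z]$ for $1-N\le n\le 0$, and $c^{(m)}_z[n]=0$ for other integers $n$. Deterministic cross-correlations. For $m,m'\in\{0,\dots,M-1\}$ and integers $n$ with $1-N\le n\le N-1$, define $$r^{(m,m')}_{c_z}[n]=\sum_{n'=1-N}^{0}c^{(m)}_z[n']\,\overline{c^{(m')}_z[n'-n]}=\delta[n+n^{(m)}_z-n^{(m')}_z].$$ Define the column vectors of length $N-1$ $${\bf r}^{(m,m')}_{c_z}[-1]=[r^{(m,m')}_{c_z}[-1],r^{(m,m')}_{c_z}[-2],\dots,r^{(m,m')}_{c_z}[1-N]]^T,$$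 $${\bf r}^{(m,m')}_{c_z}[1]=[r^{(m,m')}_{c_z}[N-1],r^{(m,m')}_{c_z}[N-2],\dots,r^{(m,m')}_{c_z}[1]]^T.$$ The matrix ${\bf R}_{c_z}$. Let ${\bf R}_{c_z}[-1]$ be the $\frac{M(M-1)}{2}\times(N-1)$ matrix whose rows are the vectors ${\bf r}^{(m,m')}_{c_z}[-1]^T$ over all pairs $(m,m')$ in $\{0,\dots,M-1\}^2$ with $m>m'$. Let ${\bf R}_{c_z}[1]$ be the $\frac{M(M-1)}{2}\times(N-1)$ matrix whose rows are the vectors ${\bf r}^{(m,m')}_{c_z}[1]^T$ over all pairs $(m,m')$ in $\{0,\dots,M-1\}^2$ with $m'>m$. (The order of the rows within each matrix is any fixed order.) Define $${\bf R}_{c_z}=\begin{bmatrix}{\bf R}_{c_z}[-1]\\ {\bf R}_{c_z}[1]\end{bmatrix}.$$ Circular sparse ruler. For a set $\mathcal{Q}\subseteq\{0,1,\dots,N-1\}$ let $\Omega(\mathcal{Q})=\{(q-q')\bmod N : q,q'\in\mathcal{Q}\}$, where residues are taken in $\{0,1,\dots,N-1\}$. A circular sparse ruler of length $N-1$ is a set $\mathcal{Q}\subseteq\{0,1,\dots,N-1\}$ such that $\Omega(\mathcal{Q})=\{0,1,\dots,N-1\}$. *)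

theory Defs
  imports "Jordan_Normal_Form.DL_Rank" Complex_Main
begin

definition selection_mat :: "nat \<Rightarrow> nat \<Rightarrow> (nat \<Rightarrow> int) \<Rightarrow> complex mat" where
  "selection_mat N M n = mat_of_rows N (map (\<lambda>m. row (1\<^sub>m N) (nat (n m))) [0..<M])"

text \<open>Row \<open>m\<close> of the selection matrix lists \<open>c[0], c[-1], \<dots>, c[1-N]\<close>,
  so column \<open>j\<close> holds the filter coefficient at time \<open>-j\<close>.\<close>

definition selection_filter :: "nat \<Rightarrow> nat \<Rightarrow> (nat \<Rightarrow> int) \<Rightarrow> nat \<Rightarrow> int \<Rightarrow> complex" where
  "selection_filter N M n m k =
     (if 1 - int N \<le> k \<and> k \<le> 0 then selection_mat N M n $$ (m, nat (- k)) else 0)"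

definition cross_corr :: "nat \<Rightarrow> nat \<Rightarrow> (nat \<Rightarrow> int) \<Rightarrow> nat \<Rightarrow> nat \<Rightarrow> int \<Rightarrow> complex" where
  "cross_corr N M n m m' k =
     (\<Sum>k' = 1 - int N..0. selection_filter N M n m k' * cnj (selection_filter N M n m' (k' - k)))"

text \<open>The vectors \<open>[r[-1], r[-2], \<dots>, r[1-N]]\<close> and \<open>[r[N-1], r[N-2], \<dots>, r[1]]\<close>.\<close>

definition corr_vec_neg :: "nat \<Rightarrow> nat \<Rightarrow> (nat \<Rightarrow> int) \<Rightarrow> nat \<Rightarrow> nat \<Rightarrow> complex vec" where
  "corr_vec_neg N M n m m' = vec (N - 1) (\<lambda>i. cross_corr N M n m m' (- 1 - int i))"

definition corr_vec_pos :: "nat \<Rightarrow> nat \<Rightarrow> (nat \<Rightarrow> int) \<Rightarrow> nat \<Rightarrow> nat \<Rightarrow> complex vec" where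
  "corr_vec_pos N M n m m' = vec (N - 1) (\<lambda>i. cross_corr N M n m m' (int N - 1 - int i))"

definition pairs_gt :: "nat \<Rightarrow> (nat \<times> nat) set" where
  "pairs_gt M = {(m, m'). m < M \<and> m' < M \<and> m > m'}"

definition pairs_lt :: "nat \<Rightarrow> (nat \<times> nat) set" where
  "pairs_lt M = {(m, m'). m < M \<and> m' < M \<and> m' > m}"

text \<open>The lists \<open>ps\<close> and \<open>qs\<close> give the order of the rows in the two blocks. They are meant to
  enumerate \<^term>\<open>pairs_gt M\<close> and \<^term>\<open>pairs_lt M\<close> without repetition.\<close>

definition corr_mat_neg :: "nat \<Rightarrow> nat \<Rightarrow> (nat \<Rightarrow> int) \<Rightarrow> (nat \<times> nat) list \<Rightarrow> complex mat" where
  "corr_mat_neg N M n ps = mat_of_rows (N - 1) (map (\<lambda>(m, m'). corr_vec_neg N M n m m') ps)"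

definition corr_mat_pos :: "nat \<Rightarrow> nat \<Rightarrow> (nat \<Rightarrow> int) \<Rightarrow> (nat \<times> nat) list \<Rightarrow> complex mat" where
  "corr_mat_pos N M n qs = mat_of_rows (N - 1) (map (\<lambda>(m, m'). corr_vec_pos N M n m m') qs)"

definition corr_mat ::
  "nat \<Rightarrow> nat \<Rightarrow> (nat \<Rightarrow> int) \<Rightarrow> (nat \<times> nat) list \<Rightarrow> (nat \<times> nat) list \<Rightarrow> complex mat" where
  "corr_mat N M n ps qs = corr_mat_neg N M n ps @\<^sub>r corr_mat_pos N M n qs"

definition circ_differences :: "nat \<Rightarrow> int set \<Rightarrow> int set" where
  "circ_differences N Q = {(q - q') mod int N | q q'. q \<in> Q \<and> q' \<in> Q}"

text \<open>The parameter is the modulus \<open>N\<close>; the length of the ruler is \<open>N - 1\<close>.\<close>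

definition circular_sparse_ruler :: "nat \<Rightarrow> int set \<Rightarrow> bool" where
  "circular_sparse_ruler N Q \<longleftrightarrow>
     Q \<subseteq> {0..int N - 1} \<and> circ_differences N Q = {0..int N - 1}"

lemma card_pairs_gt: "card (pairs_gt M) = M * (M - 1) div 2"
proof -
  have "pairs_gt M = Sigma {..<M} (\<lambda>m. {..<m})"
    by (auto simp: pairs_gt_def)
  then have "card (pairs_gt M) = (\<Sum>m<M. m)"
    by simp
  also have "\<dots> = M * (M - 1) div 2"
    by (simp add: Sum_Ico_nat lessThan_atLeast0)
  finally show ?thesis .
qed

lemma card_pairs_lt: "card (pairs_lt M) = M * (M - 1) div 2"
proof -
  have "pairs_lt M = prod.swap ` pairs_gt M"
    by (auto simp: pairs_gt_def pairs_lt_def image_iff)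
  then show ?thesis
    by (simp add: card_image card_pairs_gt)
qed

lemma corr_mat_carrier:
  assumes "distinct ps" "set ps = pairs_gt M" "distinct qs" "set qs = pairs_lt M"
  shows "corr_mat N M n ps qs \<in> carrier_mat (M * (M - 1)) (N - 1)"
proof -
  have len: "length ps = M * (M - 1) div 2" "length qs = M * (M - 1) div 2"
    using distinct_card[OF assms(1)] distinct_card[OF assms(3)]
    by (simp_all only: assms(2,4) card_pairs_gt card_pairs_lt)
  have "even (M * (M - 1))"
    by (cases M) auto
  then have dim: "M * (M - 1) div 2 + M * (M - 1) div 2 = M * (M - 1)"
    by (simp only: mult_2[symmetric] dvd_mult_div_cancel)
  have "corr_mat_neg N M n ps \<in> carrier_mat (length ps) (N - 1)"
    "corr_mat_pos N M n qs \<in> carrier_mat (length qs) (N - 1)"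
    unfolding corr_mat_neg_def corr_mat_pos_def
    using mat_of_rows_carrier(1)[of "N - 1"] by (metis length_map)+
  then have "corr_mat N M n ps qs \<in> carrier_mat (length ps + length qs) (N - 1)"
    unfolding corr_mat_def by (rule carrier_append_rows)
  then show ?thesis
    by (simp only: len dim)
qed

text \<open>The closed forms of the filters and of the cross-correlations.\<close>

lemma selection_filter_eq:
  assumes "m < M" "0 \<le> n m" "n m < int N"
  shows "selection_filter N M n m k = (if k + n m = 0 then 1 else 0)"
  using assms
  by (auto simp: selection_filter_def selection_mat_def mat_of_rows_def)

lemma cross_corr_eq:
  assumes "m < M" "0 \<le> n m" "n m < int N" "m' < M" "0 \<le> n m'" "n m' < int N"
  shows "cross_corr N M n m m' k = (if k + n m - n m' = 0 then 1 else 0)"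
proof -
  have "cross_corr N M n m m' k =
      (\<Sum>k' = 1 - int N..0. if k' = - n m then (if k + n m - n m' = 0 then 1 else 0) else 0)"
    unfolding cross_corr_def using assms
    by (intro sum.cong) (auto simp: selection_filter_eq)
  then show ?thesis
    using assms by simp
qed

end

theory Submission
  imports Defs
begin

text \<open>The matrix is a list of unit vectors in disguise. For \<open>m > m'\<close> the row of the pair
  \<open>(m, m')\<close> has its only nonzero entry at the lag \<open>-(n m - n m')\<close>, and column \<open>i\<close> of the first
  block carries the lag \<open>-(i + 1)\<close>. For \<open>m < m'\<close> the nonzero lag is \<open>n m' - n m\<close>, and column \<open>i\<close>
  of the second block carries the lag \<open>N - (i + 1)\<close>. Lags that share a column are congruent
  modulo \<open>N\<close>, so in both blocks the row is the unit vector at column \<open>d - 1\<close>, where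
  \<open>d = (n m - n m') mod N\<close> (lemmas \<open>corr_vec_neg_eq\<close> and \<open>corr_vec_pos_eq\<close>).

  A matrix whose rows are all unit vectors has full column rank exactly when each unit vector
  occurs among them: the column of a missing one vanishes, and if none is missing, then
  \<open>A v = 0\<close> forces each entry of \<open>v\<close> to be zero (lemma \<open>unit_rows_full_rank_iff\<close>). So full
  column rank means that each nonzero residue is a difference of two marks, and this is the
  ruler property, as the residue \<open>0\<close> is always a difference (lemma
  \<open>circular_sparse_ruler_image_iff\<close>).\<close>

section \<open>Matrices whose rows are unit vectors\<close>

text \<open>A linearly independent set avoids \<open>0\<close>, so a zero column contributes nothing to the rank. Counting
  the set of columns instead of the columns covers matrices with repeated columns too.\<close>

lemma (in vec_space) rank_less_if_zero_col:
  assumes A: "A \<in> carrier_mat n nc" and zero: "0\<^sub>v n \<in> set (cols A)"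
  shows "rank A < nc"
proof -
  let ?P = "\<lambda>T. T \<subseteq> set (cols A) \<and> lin_indpt T"
  obtain S where S: "maximal S ?P"
    using maximal_exists[of ?P "card (set (cols A))" "{}"]
    by (meson List.finite_set card_mono empty_iff empty_subsetI finite_lin_indpt2 rev_finite_subset)
  then have sub: "S \<subseteq> set (cols A)" and indpt: "lin_indpt S"
    by (auto simp: maximal_def)
  have "S \<subseteq> carrier_vec n"
    using sub A cols_dim by blast
  moreover have "(UNIV :: 'a set) \<noteq> {0}"
    by (metis UNIV_I singletonD zero_neq_one)
  ultimately have "0\<^sub>v n \<notin> S"
    using zero_nin_lin_indpt[OF _ indpt] by auto
  then have "S \<subset> set (cols A)"
    using sub zero by auto
  then have "card S < card (set (cols A))"
    by (intro psubset_card_mono) auto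
  also have "\<dots> \<le> nc"
    using card_length[of "cols A"] A by simp
  finally show ?thesis
    using rank_card_indpt[OF A S] by simp
qed

lemma (in vec_space) full_rank_if_unit_vecs_in_rows:
  assumes A: "A \<in> carrier_mat n nc" and units: "unit_vec nc ` {..<nc} \<subseteq> set (rows A)"
  shows "rank A = nc"
proof -
  have unit_row: "\<exists>i<n. row A i = unit_vec nc j" if "j < nc" for j
  proof -
    have "unit_vec nc j \<in> set (rows A)"
      using units that by auto
    then show ?thesis
      using A by (auto simp: in_set_conv_nth)
  qed
  have dist: "distinct (cols A)"
    unfolding distinct_conv_nth
  proof (intro allI impI)
    fix j k
    assume jk: "j < length (cols A)" "k < length (cols A)" "j \<noteq> k"
    then have less: "j < nc" "k < nc"
      using A by auto
    \<comment> \<open>The unit vector at \<open>j\<close>, as a row, tells column \<open>j\<close> apart from all other columns.\<close>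
    obtain i where i: "i < n" "row A i = unit_vec nc j"
      using unit_row[OF less(1)] by blast
    have "A $$ (i, l) = unit_vec nc j $ l" if "l < nc" for l
      using A i that index_row(1)[of i A l] by simp
    then have "col A j $ i \<noteq> col A k $ i"
      using A i(1) less jk(3) by simp
    then show "cols A ! j \<noteq> cols A ! k"
      using A less by auto
  qed
  have "lin_indpt (set (cols A))"
  proof
    assume "lin_dep (set (cols A))"
    then obtain v where v: "v \<in> carrier_vec nc" "v \<noteq> 0\<^sub>v nc" "A *\<^sub>v v = 0\<^sub>v n"
      using lin_depE[OF A _ dist] by blast
    have "v $ j = 0" if j: "j < nc" for j
    proof -
      obtain i where i: "i < n" "row A i = unit_vec nc j"
        using unit_row[OF j] by blast
      have "v $ j = row A i \<bullet> v"
        using i(2) v(1) j by simp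
      also have "\<dots> = (A *\<^sub>v v) $ i"
        using A i(1) by simp
      finally show ?thesis
        using v(3) i(1) by simp
    qed
    then show False
      using v(1,2) by auto
  qed
  then show ?thesis
    by (rule lin_indpt_full_rank[OF A dist])
qed

lemma (in vec_space) unit_rows_full_rank_iff:
  assumes A: "A \<in> carrier_mat n nc" and rows: "set (rows A) \<subseteq> unit_vec nc ` {..<nc}"
  shows "rank A = nc \<longleftrightarrow> set (rows A) = unit_vec nc ` {..<nc}"
proof
  assume full: "rank A = nc"
  show "set (rows A) = unit_vec nc ` {..<nc}"
  proof (rule ccontr)
    assume "set (rows A) \<noteq> unit_vec nc ` {..<nc}"
    then obtain j where j: "j < nc" "unit_vec nc j \<notin> set (rows A)"
      using rows by auto
    have "col A j = 0\<^sub>v n"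
    proof
      fix i
      assume "i < dim_vec (0\<^sub>v n)"
      then have i: "i < n"
        by simp
      then have row: "row A i \<in> set (rows A)"
        using A by (auto simp: rows_def)
      then obtain k where k: "k < nc" "row A i = unit_vec nc k"
        using rows by auto
      then have "k \<noteq> j"
        using row j(2) by auto
      then have "row A i $ j = 0"
        using k j(1) by simp
      then show "col A j $ i = 0\<^sub>v n $ i"
        using A i j(1) by simp
    qed (use A in simp)
    moreover have "col A j \<in> set (cols A)"
      using A j(1) by (auto simp: cols_def)
    ultimately show False
      using rank_less_if_zero_col[OF A] full by simp
  qed
next
  assume "set (rows A) = unit_vec nc ` {..<nc}"
  then show "rank A = nc"
    by (intro full_rank_if_unit_vecs_in_rows[OF A]) simp
qed

section \<open>The rows of the correlation matrix\<close>

lemma rows_append_rows: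
  assumes "A \<in> carrier_mat nr1 nc" "B \<in> carrier_mat nr2 nc"
  shows "rows (A @\<^sub>r B) = rows A @ rows B"
proof (rule nth_equalityI)
  show "length (rows (A @\<^sub>r B)) = length (rows A @ rows B)"
    using assms by (simp add: append_rows_def)
  fix i
  assume "i < length (rows (A @\<^sub>r B))"
  then have "i < nr1 + nr2"
    using assms by (simp add: append_rows_def)
  then show "rows (A @\<^sub>r B) ! i = (rows A @ rows B) ! i"
    using assms by (auto simp: append_rows_def nth_append intro!: eq_vecI)
qed

lemma set_rows_corr_mat:
  "set (rows (corr_mat N M n ps qs)) =
     (\<lambda>(m, m'). corr_vec_neg N M n m m') ` set ps \<union> (\<lambda>(m, m'). corr_vec_pos N M n m m') ` set qs"
proof -
  have "rows (corr_mat_neg N M n ps) = map (\<lambda>(m, m'). corr_vec_neg N M n m m') ps"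
    unfolding corr_mat_neg_def by (rule rows_mat_of_rows) (auto simp: corr_vec_neg_def)
  moreover have "rows (corr_mat_pos N M n qs) = map (\<lambda>(m, m'). corr_vec_pos N M n m m') qs"
    unfolding corr_mat_pos_def by (rule rows_mat_of_rows) (auto simp: corr_vec_pos_def)
  moreover have "rows (corr_mat N M n ps qs) =
      rows (corr_mat_neg N M n ps) @ rows (corr_mat_pos N M n qs)"
    unfolding corr_mat_def corr_mat_neg_def corr_mat_pos_def
    by (rule rows_append_rows) (rule mat_of_rows_carrier(1))+
  ultimately show ?thesis
    by simp
qed

text \<open>The subtraction of \<open>1\<close> turns the nonzero residues \<open>1, \<dots>, N - 1\<close> into column indices, which
  start at \<open>0\<close>.\<close>

definition residue_col :: "nat \<Rightarrow> int \<Rightarrow> nat" where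
  "residue_col N d = nat (d mod int N) - 1"

lemma corr_vec_neg_eq:
  assumes "m < M" "m' < M" "0 \<le> n m'" "n m' < n m" "n m < int N"
  shows "corr_vec_neg N M n m m' = unit_vec (N - 1) (residue_col N (n m - n m'))"
proof -
  have "(n m - n m') mod int N = n m - n m'"
    using assms by (intro mod_pos_pos_trivial) auto
  then show ?thesis
    using assms
    by (auto simp: residue_col_def corr_vec_neg_def cross_corr_eq unit_vec_def intro!: eq_vecI)
qed

lemma corr_vec_pos_eq:
  assumes "m < M" "m' < M" "0 \<le> n m" "n m < n m'" "n m' < int N"
  shows "corr_vec_pos N M n m m' = unit_vec (N - 1) (residue_col N (n m - n m'))"
proof -
  have "(n m - n m') mod int N = (n m - n m' + int N) mod int N"
    by simp
  also have "\<dots> = n m - n m' + int N"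
    using assms by (intro mod_pos_pos_trivial) auto
  finally show ?thesis
    using assms
    by (auto simp: residue_col_def corr_vec_pos_def cross_corr_eq unit_vec_def intro!: eq_vecI)
qed

section \<open>Differences of marks and full column rank\<close>

text \<open>The residue \<open>0\<close> comes from \<open>m = m'\<close>, a pair without a row in the matrix; this is why the
  matrix has \<open>N - 1\<close> columns and not \<open>N\<close>.\<close>

lemma circular_sparse_ruler_image_iff:
  assumes N: "N > 0" and M: "M > 0"
    and range: "\<And>m. m < M \<Longrightarrow> 0 \<le> n m \<and> n m < int N"
    and inj: "inj_on n {..<M}"
  shows "circular_sparse_ruler N (n ` {..<M}) \<longleftrightarrow>
    (\<lambda>(m, m'). residue_col N (n m - n m')) ` {(m, m'). m < M \<and> m' < M \<and> m \<noteq> m'} = {..<N - 1}"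
    (is "_ \<longleftrightarrow> ?c ` ?P = _")
proof -
  let ?d = "\<lambda>(m, m'). (n m - n m') mod int N"
  have "circ_differences N (n ` {..<M}) = ?d ` ({..<M} \<times> {..<M})"
    by (fastforce simp: circ_differences_def)
  also have "{..<M} \<times> {..<M} = (\<lambda>m. (m, m)) ` {..<M} \<union> ?P"
    by auto
  also have "?d ` \<dots> = insert 0 (?d ` ?P)"
    using M by (auto simp: image_Un image_image)
  finally have diffs: "circ_differences N (n ` {..<M}) = insert 0 (?d ` ?P)" .
  have nz: "?d ` ?P \<subseteq> {1..int N - 1}"
  proof clarify
    fix m m'
    assume m: "m < M" "m' < M" "m \<noteq> m'"
    have "(n m - n m') mod int N \<noteq> 0"
    proof
      assume "(n m - n m') mod int N = 0"
      then have "n m mod int N = n m' mod int N"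
        by (simp add: mod_eq_dvd_iff mod_0_imp_dvd)
      then have "n m = n m'"
        using range[OF m(1)] range[OF m(2)] by simp
      then show False
        using inj m by (auto dest: inj_onD)
    qed
    moreover have "0 \<le> (n m - n m') mod int N" "(n m - n m') mod int N < int N"
      using N by simp_all
    ultimately show "(n m - n m') mod int N \<in> {1..int N - 1}"
      by simp
  qed
  have "n ` {..<M} \<subseteq> {0..int N - 1}"
    using range by fastforce
  moreover have "{0..int N - 1} = insert 0 {1..int N - 1}"
    using N by auto
  ultimately have "circular_sparse_ruler N (n ` {..<M}) \<longleftrightarrow>
      insert 0 (?d ` ?P) = insert 0 {1..int N - 1}"
    by (simp only: circular_sparse_ruler_def diffs simp_thms)
  also have "\<dots> \<longleftrightarrow> ?d ` ?P = {1..int N - 1}"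
    using nz by (intro insert_ident) auto
  also have "\<dots> \<longleftrightarrow> (\<lambda>d. nat d - 1) ` ?d ` ?P = (\<lambda>d. nat d - 1) ` {1..int N - 1}"
    using nz by (intro inj_on_image_eq_iff[symmetric, where C = "{1..int N - 1}"] inj_onI) auto
  also have "(\<lambda>d. nat d - 1) ` ?d ` ?P = ?c ` ?P"
    by (simp add: image_image residue_col_def split_beta)
  also have "(\<lambda>d. nat d - 1) ` {1..int N - 1} = {..<N - 1}"
  proof
    show "{..<N - 1} \<subseteq> (\<lambda>d. nat d - 1) ` {1..int N - 1}"
      by (rule subsetI, rule_tac x = "int x + 1" in image_eqI) auto
  qed auto
  finally show ?thesis .
qed

theorem theorem1:
  fixes N M :: nat
    and n :: "nat \<Rightarrow> int"
    and ps qs :: "(nat \<times> nat) list"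
  assumes "N > 0" and "M > 0" and "M \<le> N"
    and "strict_mono_on {..<M} n"
    and "\<And>m. m < M \<Longrightarrow> 0 \<le> n m \<and> n m \<le> int N - 1"
    and "distinct ps" and "set ps = pairs_gt M"
    and "distinct qs" and "set qs = pairs_lt M"
  shows "vec_space.rank (M * (M - 1)) (corr_mat N M n ps qs) = N - 1
           \<longleftrightarrow> circular_sparse_ruler N (n ` {..<M})"
proof -
  let ?A = "corr_mat N M n ps qs"
  let ?c = "\<lambda>(m, m'). residue_col N (n m - n m')"
  let ?P = "{(m, m'). m < M \<and> m' < M \<and> m \<noteq> m'}"
  have range: "0 \<le> n m \<and> n m < int N" if "m < M" for m
    using assms(5)[OF that] by auto
  have less: "n m < n m'" if "m < m'" "m' < M" for m m'
    using strict_mono_onD[OF assms(4)] that by auto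
  have "set (rows ?A) =
      (\<lambda>p. unit_vec (N - 1) (?c p)) ` pairs_gt M \<union> (\<lambda>p. unit_vec (N - 1) (?c p)) ` pairs_lt M"
    unfolding set_rows_corr_mat assms(7,9)
    by (intro arg_cong2[where f = "(\<union>)"] image_cong refl)
      (auto simp: pairs_gt_def pairs_lt_def range less corr_vec_neg_eq corr_vec_pos_eq)
  also have "\<dots> = (\<lambda>p. unit_vec (N - 1) (?c p)) ` (pairs_gt M \<union> pairs_lt M)"
    by (rule image_Un[symmetric])
  also have "pairs_gt M \<union> pairs_lt M = ?P"
    by (auto simp: pairs_gt_def pairs_lt_def)
  finally have rows: "set (rows ?A) = unit_vec (N - 1) ` ?c ` ?P"
    by (simp add: image_image)
  have inj: "inj_on n {..<M}"
    using assms(4) by (rule strict_mono_on_imp_inj_on)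
  have cols: "?c ` ?P \<subseteq> {..<N - 1}"
  proof clarify
    fix m m'
    assume m: "m < M" "m' < M" "m \<noteq> m'"
    \<comment> \<open>Two distinct marks need \<open>N \<ge> 2\<close>, so that the matrix has a column at all.\<close>
    then have "N \<noteq> 1"
      using assms(3) by auto
    moreover have "nat ((n m - n m') mod int N) < N"
      using assms(1) by (simp add: nat_less_iff)
    ultimately show "residue_col N (n m - n m') < N - 1"
      using assms(1) by (auto simp: residue_col_def)
  qed
  have "vec_space.rank (M * (M - 1)) ?A = N - 1 \<longleftrightarrow> set (rows ?A) = unit_vec (N - 1) ` {..<N - 1}"
    using corr_mat_carrier[OF assms(6-9)] cols
    by (intro vec_space.unit_rows_full_rank_iff) (auto simp: rows)
  also have "\<dots> \<longleftrightarrow> ?c ` ?P = {..<N - 1}"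
    unfolding rows using cols
    by (intro inj_on_image_eq_iff[where C = "{..<N - 1}"] inj_onI) auto
  also have "\<dots> \<longleftrightarrow> circular_sparse_ruler N (n ` {..<M})"
    using circular_sparse_ruler_image_iff[OF assms(1,2) range inj] by simp
  finally show ?thesis .
qed

end
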